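(* Let $X$ be a finite nonempty set of keys, $\Sigma$ a set, $q\in\mathbb{N}$ with $q\ge 1$, $m\in\mathbb{N}$, let $\mathcal{H}=\{h_x:\Sigma\to[2^q]\}_{x\in X}$ be any family of functions, and let $\sigma:\{0,\dots,q-1\}\times\{0,\dots,m\}\to\Sigma$ be injective. Define $\tilde f(x,2^r)$ for $x\in X$ and $r\in\{0,\dots,q\}$ as follows: $a= h_x(\sigma(0,0))\bmod 2^r$; $b=\lfloor\log_2 a\rfloor$ if $a>0$ and $b=0$ otherwise; $c=h_x(\sigma(b,0))\bmod 2^b$; $\tilde f(x,2^r)=a\oplus c$. Then $\tilde f$ is monotone: for all $x\in X$ and all $r,r'\in\{0,\dots,q\}$ with $r<r'$, if $\tilde f(x,2^{r'})<2^r$ then $\tilde f(x,2^{r'})=\tilde f(x,2^r)$.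
   Context: $[N]=\{0,1,\dots,N-1\}$. $\oplus$ denotes bitwise exclusive-or of nonnegative integers in binary. Note $\tilde f(x,2^r)\in[2^r]$. *)

theory Defs
  imports Complex_Main "HOL-Library.FuncSet"
begin

text \<open>The argument \<open>N\<close> is the size of the range, intended to be a power of two.\<close>

definition ftilde_a :: "('k \<Rightarrow> 's \<Rightarrow> nat) \<Rightarrow> (nat \<times> nat \<Rightarrow> 's) \<Rightarrow> 'k \<Rightarrow> nat \<Rightarrow> nat" where
  "ftilde_a h \<sigma> x N = h x (\<sigma> (0, 0)) mod N"

definition ftilde_b :: "('k \<Rightarrow> 's \<Rightarrow> nat) \<Rightarrow> (nat \<times> nat \<Rightarrow> 's) \<Rightarrow> 'k \<Rightarrow> nat \<Rightarrow> nat" where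
  "ftilde_b h \<sigma> x N =
     (if ftilde_a h \<sigma> x N > 0 then nat \<lfloor>log 2 (real (ftilde_a h \<sigma> x N))\<rfloor> else 0)"

definition ftilde_c :: "('k \<Rightarrow> 's \<Rightarrow> nat) \<Rightarrow> (nat \<times> nat \<Rightarrow> 's) \<Rightarrow> 'k \<Rightarrow> nat \<Rightarrow> nat" where
  "ftilde_c h \<sigma> x N = h x (\<sigma> (ftilde_b h \<sigma> x N, 0)) mod 2 ^ ftilde_b h \<sigma> x N"

definition ftilde :: "('k \<Rightarrow> 's \<Rightarrow> nat) \<Rightarrow> (nat \<times> nat \<Rightarrow> 's) \<Rightarrow> 'k \<Rightarrow> nat \<Rightarrow> nat" where
  "ftilde h \<sigma> x N = Bit_Operations.xor (ftilde_a h \<sigma> x N) (ftilde_c h \<sigma> x N)"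

end

theory Submission
  imports Defs
begin

text \<open>For a positive hash \<open>a\<close>, the correction \<open>c\<close> only touches the bits below the leading bit
  of \<open>a\<close>. Hence \<open>a \<oplus> c\<close> lies below \<open>2 ^ r\<close> only if \<open>a\<close> does; then reducing \<open>a\<close> modulo
  \<open>2 ^ r\<close> leaves it unchanged, and with it \<open>b\<close>, \<open>c\<close> and \<open>a \<oplus> c\<close>.\<close>

lemma xor_nat_less_exp:
  fixes m n k :: nat
  assumes "m < 2 ^ k" and "n < 2 ^ k"
  shows "Bit_Operations.xor m n < 2 ^ k"
proof -
  have "take_bit k (Bit_Operations.xor m n) = Bit_Operations.xor m n"
    using assms by (simp add: take_bit_xor take_bit_nat_eq_self)
  then show ?thesis
    by (metis take_bit_nat_less_exp)
qed

text \<open>If \<open>b < r\<close>, the upper bound on \<open>a\<close> suffices. Otherwise the xor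
  would have no bit at position \<open>b\<close> or above, although \<open>c\<close> cannot clear
  the leading bit of \<open>a\<close>.\<close>

lemma less_exp_if_xor_less_exp:
  fixes a c b r :: nat
  assumes lower: "2 ^ b \<le> a" and upper: "a < 2 ^ Suc b" and c: "c < 2 ^ b"
    and xor: "Bit_Operations.xor a c < 2 ^ r"
  shows "a < 2 ^ r"
proof (cases "b < r")
  case True
  then have "(2::nat) ^ Suc b \<le> 2 ^ r"
    by (intro power_increasing) auto
  with upper show ?thesis
    by linarith
next
  case False
  then have "(2::nat) ^ r \<le> 2 ^ b"
    by (intro power_increasing) auto
  with xor have "Bit_Operations.xor a c < 2 ^ b"
    by linarith
  \<comment> \<open>Xoring with \<open>c\<close> a second time recovers \<open>a\<close>, which
    contradicts \<open>lower\<close>.\<close>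
  then have "Bit_Operations.xor (Bit_Operations.xor a c) c < 2 ^ b"
    using c by (rule xor_nat_less_exp)
  then have "a < 2 ^ b"
    by (simp add: xor.assoc)
  with lower show ?thesis
    by simp
qed

lemma ftilde_a_bounds:
  assumes "ftilde_a h \<sigma> x N > 0"
  shows "2 ^ ftilde_b h \<sigma> x N \<le> ftilde_a h \<sigma> x N"
    and "ftilde_a h \<sigma> x N < 2 ^ Suc (ftilde_b h \<sigma> x N)"
proof -
  let ?a = "ftilde_a h \<sigma> x N" and ?b = "ftilde_b h \<sigma> x N"
  \<comment> \<open>Since \<open>?a\<close> is at least 1, its logarithm is nonnegative and
    \<open>nat\<close> in the definition of \<open>?b\<close> truncates nothing.\<close>
  have "\<lfloor>log (real 2) (real ?a)\<rfloor> = int ?b"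
    using assms by (simp add: ftilde_b_def)
  then have "2 ^ ?b \<le> ?a \<and> ?a < 2 ^ (?b + 1)"
    using assms by (subst (asm) floor_log_nat_eq_powr_iff) auto
  then show "2 ^ ?b \<le> ?a" and "?a < 2 ^ Suc ?b"
    by simp_all
qed

lemma ftilde_a_less_if_ftilde_less:
  assumes "ftilde h \<sigma> x N < 2 ^ r"
  shows "ftilde_a h \<sigma> x N < 2 ^ r"
\<comment> \<open>Zero has no leading bit, but it lies below every power of two.\<close>
proof (cases "ftilde_a h \<sigma> x N > 0")
  case True
  have "ftilde_c h \<sigma> x N < 2 ^ ftilde_b h \<sigma> x N"
    by (simp add: ftilde_c_def)
  then show ?thesis
    using less_exp_if_xor_less_exp[OF ftilde_a_bounds[OF True]] assms
    by (simp add: ftilde_def)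
qed simp

lemma ftilde_monotone:
  assumes "r \<le> r'" and "ftilde h \<sigma> x (2 ^ r') < 2 ^ r"
  shows "ftilde h \<sigma> x (2 ^ r') = ftilde h \<sigma> x (2 ^ r)"
proof -
  \<comment> \<open>Divisibility lets the two nested reductions of the hash collapse into the one
    modulo \<open>2 ^ r\<close>.\<close>
  have "(2::nat) ^ r dvd 2 ^ r'"
    using assms(1) by (rule le_imp_power_dvd)
  then have "ftilde_a h \<sigma> x (2 ^ r) = ftilde_a h \<sigma> x (2 ^ r') mod 2 ^ r"
    by (simp add: ftilde_a_def mod_mod_cancel)
  then have "ftilde_a h \<sigma> x (2 ^ r) = ftilde_a h \<sigma> x (2 ^ r')"
    using ftilde_a_less_if_ftilde_less[OF assms(2)] by simp
  \<comment> \<open>The range size enters \<open>b\<close> and \<open>c\<close> only through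
    \<open>a\<close>.\<close>
  then show ?thesis
    by (simp add: ftilde_def ftilde_c_def ftilde_b_def)
qed

theorem theorem2p1:
  fixes X :: "'k set" and \<Sigma> :: "'s set" and q m :: nat
    and h :: "'k \<Rightarrow> 's \<Rightarrow> nat" and \<sigma> :: "nat \<times> nat \<Rightarrow> 's"
  assumes "finite X" and "X \<noteq> {}" and "q \<ge> 1"
    and "\<And>x. x \<in> X \<Longrightarrow> h x \<in> \<Sigma> \<rightarrow> {0..<2 ^ q}"
    and "\<sigma> \<in> {0..<q} \<times> {0..m} \<rightarrow> \<Sigma>"
    and "inj_on \<sigma> ({0..<q} \<times> {0..m})"
  shows "\<forall>x\<in>X. \<forall>r\<in>{0..q}. \<forall>r'\<in>{0..q}. r < r' \<longrightarrow>
           ftilde h \<sigma> x (2 ^ r') < 2 ^ r \<longrightarrow>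
           ftilde h \<sigma> x (2 ^ r') = ftilde h \<sigma> x (2 ^ r)"
  by (auto intro!: ftilde_monotone)

end
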